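(* Let $j\geq 2$ and $n\geq j$ be integers and let $f\in C[0,1]$ be a decreasing and convex function. Then $$B_{n,j}(f;x)\geq B_n(f;x)\geq f(x)\quad\text{for all } x\in[0,1].$$
   Context: "Decreasing" is meant in the weak sense (nonincreasing). With $p_{n,k}(x)=\binom{n}{k}x^k(1-x)^{n-k}$, the Bernstein operator $B_n$ and the Aldaz-Kounchev-Render operator $B_{n,j}$ (for integers $j\geq 2$, $n\geq j$) are defined on $C[0,1]$ by $$B_n(f;x)=\sum_{k=0}^n f\left(\frac{k}{n}\right)p_{n,k}(x),\qquad B_{n,j}(f;x)=\sum_{k=0}^n f\left(t_{n,k}^j\right)p_{n,k}(x),$$ where $$t_{n,k}^j=\left(\frac{k(k-1)\cdots(k-j+1)}{n(n-1)\cdots(n-j+1)}\right)^{1/j}$$ (the superscript $j$ in $t_{n,k}^j$ is an index, not a power). *)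

theory Defs
  imports "HOL-Analysis.Analysis"
begin

text \<open>The basis polynomials are the library's \<^const>\<open>Bernstein\<close>. A function in \<open>C[0,1]\<close> is
  represented by a function on the reals; all nodes below lie in \<open>[0,1]\<close>, so only its values
  there matter.\<close>

definition bernstein_op :: "nat \<Rightarrow> (real \<Rightarrow> real) \<Rightarrow> real \<Rightarrow> real" where
  "bernstein_op n f x = (\<Sum>k\<le>n. f (real k / real n) * Bernstein n k x)"

text \<open>The differences are taken in the reals. For \<open>k < j\<close> the numerator has the factor \<open>k - k\<close>,
  so the radicand is never negative when \<open>k \<le> n\<close> and \<open>j \<le> n\<close>.\<close>

definition akr_node :: "nat \<Rightarrow> nat \<Rightarrow> nat \<Rightarrow> real" where
  "akr_node j n k =
     root j ((\<Prod>i<j. real k - real i) / (\<Prod>i<j. real n - real i))"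

text \<open>The Aldaz--Kounchev--Render operator \<open>B\<^sub>n\<^sub>,\<^sub>j\<close>.\<close>

definition akr_op :: "nat \<Rightarrow> nat \<Rightarrow> (real \<Rightarrow> real) \<Rightarrow> real \<Rightarrow> real" where
  "akr_op n j f x = (\<Sum>k\<le>n. f (akr_node j n k) * Bernstein n k x)"

end

theory Submission
  imports Defs
begin

text \<open>The argument separates the two inequalities. For the first one, the \<open>j\<close>-th power of a node of
  \<open>B\<^sub>n\<^sub>,\<^sub>j\<close> is a product of \<open>j\<close> quotients \<open>(k - i) / (n - i)\<close>, none of which exceeds \<open>k / n\<close>;
  so the node lies to the left of \<open>k / n\<close> (lemma \<open>akr_node_le\<close>), and a decreasing \<open>f\<close> is at
  least as large there. The two operators share their nonnegative weights, hence the comparison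
  of the values carries over to the sums. For the second inequality, the weights of \<open>B\<^sub>n\<close> are a
  probability distribution on the points \<open>k / n\<close> with mean \<open>x\<close>, and the claim is Jensen's
  inequality (lemma \<open>bernstein_op_ge_convex\<close>).\<close>

text \<open>For \<open>k < j\<close> the numerator may contain negative factors, but the factor with \<open>i = k\<close>
  annihilates the product. For \<open>k \<ge> j\<close> all factors are nonnegative and the product can be
  estimated factor by factor.\<close>

lemma falling_factorial_ratio_bounds:
  fixes j n k :: nat
  assumes "j \<le> n" "k \<le> n"
  shows "0 \<le> (\<Prod>i<j. real k - real i) / (\<Prod>i<j. real n - real i)"
    and "(\<Prod>i<j. real k - real i) / (\<Prod>i<j. real n - real i) \<le> (real k / real n) ^ j"
proof -
  let ?P = "(\<Prod>i<j. real k - real i) / (\<Prod>i<j. real n - real i)"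
  have "0 \<le> ?P \<and> ?P \<le> (real k / real n) ^ j"
  proof (cases "k < j")
    case True
    then have "(\<Prod>i<j. real k - real i) = 0"
      by (intro prod_zero) auto
    then show ?thesis by (simp only:) simp
  next
    case False
    have P: "?P = (\<Prod>i<j. (real k - real i) / (real n - real i))"
      by (simp add: prod_dividef)
    have bounds: "0 \<le> (real k - real i) / (real n - real i)"
      "(real k - real i) / (real n - real i) \<le> real k / real n" if "i < j" for i
    proof -
      have "i < n" "i \<le> k" using that assms False by auto
      then show "0 \<le> (real k - real i) / (real n - real i)" by simp
      have "real i * real k \<le> real i * real n" using assms by (intro mult_left_mono) auto
      then have "(real k - real i) * real n \<le> real k * (real n - real i)"
        by (simp add: algebra_simps)
      then show "(real k - real i) / (real n - real i) \<le> real k / real n"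
        using \<open>i < n\<close> by (simp add: divide_le_eq le_divide_eq field_simps)
    qed
    have "(\<Prod>i<j. (real k - real i) / (real n - real i)) \<le> (\<Prod>i<j. real k / real n)"
      using bounds by (intro prod_mono) auto
    moreover have "0 \<le> (\<Prod>i<j. (real k - real i) / (real n - real i))"
      using bounds by (intro prod_nonneg) auto
    ultimately show ?thesis unfolding P by simp
  qed
  then show "0 \<le> ?P" "?P \<le> (real k / real n) ^ j" by auto
qed

lemma akr_node_nonneg:
  assumes "j \<le> n" "k \<le> n"
  shows "0 \<le> akr_node j n k"
  unfolding akr_node_def
  using falling_factorial_ratio_bounds(1)[OF assms] by (rule real_root_ge_zero)

lemma akr_node_le:
  assumes "0 < j" "j \<le> n" "k \<le> n"
  shows "akr_node j n k \<le> real k / real n"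
proof -
  have "akr_node j n k \<le> root j ((real k / real n) ^ j)"
    unfolding akr_node_def
    using falling_factorial_ratio_bounds(2)[OF assms(2,3)] assms(1)
    by (simp add: real_root_le_iff)
  also have "\<dots> = real k / real n"
    using assms(1) by (simp add: real_root_power_cancel)
  finally show ?thesis .
qed

lemma bernstein_op_le_akr_op:
  assumes "0 < j" "j \<le> n" "antimono_on {0..1} f" "x \<in> {0..1}"
  shows "bernstein_op n f x \<le> akr_op n j f x"
  unfolding bernstein_op_def akr_op_def
proof (intro sum_mono mult_right_mono)
  fix k assume "k \<in> {..n}"
  then have "0 \<le> akr_node j n k" "akr_node j n k \<le> real k / real n" "real k / real n \<le> 1"
    using assms akr_node_nonneg[of j n k] akr_node_le[of j n k] by (auto simp: divide_le_eq)
  then show "f (real k / real n) \<le> f (akr_node j n k)"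
    using assms(3) by (intro monotone_onD[OF assms(3)]) auto
next
  fix k show "0 \<le> Bernstein n k x"
    using assms(4) by (simp add: Bernstein_nonneg)
qed

text \<open>Jensen's inequality: the Bernstein weights sum to 1, and \<open>sum_k_Bernstein\<close> computes their
  mean. For \<open>n = 0\<close> the only node is the default value \<open>0 / 0 = 0\<close>, not the mean \<open>x\<close>.\<close>

lemma bernstein_op_ge_convex:
  assumes "0 < n" "convex_on {0..1} f" "x \<in> {0..1}"
  shows "f x \<le> bernstein_op n f x"
proof -
  have "(\<Sum>k\<le>n. Bernstein n k x *\<^sub>R (real k / real n)) = (\<Sum>k\<le>n. real k * Bernstein n k x) / n"
    by (simp add: sum_divide_distrib mult.commute del: sum_k_Bernstein)
  also have "\<dots> = x"
    using assms(1) by simp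
  finally have mean: "(\<Sum>k\<le>n. Bernstein n k x *\<^sub>R (real k / real n)) = x" .
  have "f (\<Sum>k\<le>n. Bernstein n k x *\<^sub>R (real k / real n))
      \<le> (\<Sum>k\<le>n. Bernstein n k x * f (real k / real n))"
    using assms by (intro convex_on_sum[OF _ _ assms(2)]) (auto simp: Bernstein_nonneg divide_le_eq)
  then show ?thesis
    unfolding mean bernstein_op_def by (simp add: mult.commute)
qed

theorem proposition3p2:
  fixes j n :: nat and f :: "real \<Rightarrow> real"
  assumes "j \<ge> 2" and "n \<ge> j"
    and "continuous_on {0..1} f"
    and "antimono_on {0..1} f"
    and "convex_on {0..1} f"
  shows "\<forall>x\<in>{0..1}. akr_op n j f x \<ge> bernstein_op n f x \<and> bernstein_op n f x \<ge> f x"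
  using assms bernstein_op_le_akr_op[of j n f] bernstein_op_ge_convex[of n f] by auto

end
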